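(* Let $f\in\mathcal{HK}$. For $x,y\in\mathbb{R}$ define $\tau_xf(y)=f(y-x)$. Then $\|\tau_xf-f\|\to 0$ as $x\to 0$.
   Context: $\mathcal{HK}$ denotes the set of functions $f:\mathbb{R}\to\mathbb{R}$ that are Henstock--Kurzweil integrable on the whole real line. The Alexiewicz norm of $f\in\mathcal{HK}$ is $\|f\|=\sup_I\left|\int_I f\right|$, where the supremum is over all intervals $I\subset\mathbb{R}$ (bounded or unbounded) and the integral is the Henstock--Kurzweil integral. Functions equal almost everywhere are identified. *)

theory Defs
  imports "HOL-Analysis.Analysis"
begin

text \<open>
  On an unbounded domain, \<open>integrable_on\<close> asks that the gauge integrals over all compact intervals
  exist and converge as the two endpoints tend independently to minus and plus infinity. By Hake's
  theorem this is Henstock--Kurzweil integrability on the extended line, so conditionally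
  convergent improper integrals are included.
\<close>
definition HK :: "(real \<Rightarrow> real) set"
  where "HK = {f. f integrable_on UNIV}"

definition translate :: "real \<Rightarrow> (real \<Rightarrow> real) \<Rightarrow> real \<Rightarrow> real"
  where "translate x f = (\<lambda>y. f (y - x))"

text \<open>
  \<open>is_interval\<close> covers open, closed, half-open, degenerate, bounded and unbounded intervals.
  The real-valued supremum is meaningful on \<open>HK\<close> by \<open>bdd_above_alexiewicz\<close> below. No quotient by
  almost-everywhere equality is taken: the norm depends only on the a.e. class of its argument.
\<close>
definition alexiewicz_norm :: "(real \<Rightarrow> real) \<Rightarrow> real"
  where "alexiewicz_norm f = (SUP I\<in>{I. is_interval I}. \<bar>integral I f\<bar>)"

lemma HK_bounded_compact_intervals:
  fixes f :: "real \<Rightarrow> real"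
  assumes "f \<in> HK"
  obtains C where "\<And>a b. \<bar>integral {a..b} f\<bar> \<le> C"
proof -
  have f: "f integrable_on UNIV" using assms by (simp add: HK_def)
  have int: "f integrable_on {a..b}" for a b
    using integrable_on_subinterval[OF f] by auto
  have nb: "\<nexists>a b::real. UNIV = cbox a b"
    by (metis bounded_cbox not_bounded_UNIV)
  obtain B where B: "B > 0" "\<And>a b. ball 0 B \<subseteq> cbox a b \<Longrightarrow>
      \<exists>z. (f has_integral z) (cbox a b) \<and> norm (z - integral UNIV f) < 1"
    using has_integral_altD[OF integrable_integral[OF f] nb zero_less_one] by auto
  have out: "\<bar>integral {a..b} f\<bar> \<le> \<bar>integral UNIV f\<bar> + 1" if "a \<le> -B" "B \<le> b" for a b
  proof -
    have "ball 0 B \<subseteq> cbox a b" using that by (auto simp: dist_real_def)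
    from B(2)[OF this] obtain z where "(f has_integral z) {a..b}" "\<bar>z - integral UNIV f\<bar> < 1"
      by auto
    then show ?thesis by (auto dest!: integral_unique)
  qed
  obtain K where K: "\<And>a b. {a..b} \<subseteq> {-B..B} \<Longrightarrow> \<bar>integral {a..b} f\<bar> \<le> K"
  proof -
    have "bounded {integral (cbox c d) f |c d. cbox c d \<subseteq> cbox (-B) B}"
      by (rule bounded_integrals_over_subintervals) (use int in simp)
    then obtain K where "\<And>x. x \<in> {integral (cbox c d) f |c d. cbox c d \<subseteq> cbox (-B) B} \<Longrightarrow> norm x \<le> K"
      unfolding bounded_iff by blast
    then show ?thesis by (intro that[of K]) (metis (mono_tags, lifting) cbox_interval mem_Collect_eq real_norm_def)
  qed
  have comb: "integral {a..b} f + integral {b..c} f = integral {a..c} f" if "a \<le> b" "b \<le> c" for a b c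
    using Henstock_Kurzweil_Integration.integral_combine[OF that int] .
  define M where "M = \<bar>integral UNIV f\<bar> + 1 + \<bar>K\<bar>"
  have G: "\<bar>integral {a..B} f\<bar> \<le> M" if "a \<le> B" for a
    using out[of a B] K[of a B] that by (cases "a \<le> -B") (auto simp: M_def)
  have H: "\<bar>integral {-B..b} f\<bar> \<le> M" if "-B \<le> b" for b
    using out[of "-B" b] K[of "-B" b] that by (cases "B \<le> b") (auto simp: M_def)
  have M0: "0 \<le> M" by (simp add: M_def)
  have "\<bar>integral {a..b} f\<bar> \<le> 3 * M" for a b
  proof -
    consider "b < a" | "a \<le> b" "B \<le> a" | "a \<le> b" "b \<le> B" | "a < B" "B < b" by linarith
    then show ?thesis
    proof cases
      case 1 then show ?thesis using M0 by simp
    next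
      case 2 then show ?thesis using comb[of "-B" a b] H[of a] H[of b] B(1) M0 by linarith
    next
      case 3 then show ?thesis using comb[of a b B] G[of a] G[of b] M0 by linarith
    next
      case 4 then show ?thesis
        using comb[of "-B" B b] comb[of a B b] H[of B] H[of b] G[of a] B(1) M0 by linarith
    qed
  qed
  then show ?thesis by (rule that)
qed

lemma bdd_above_alexiewicz:
  assumes "f \<in> HK"
  shows "bdd_above ((\<lambda>I. \<bar>integral I f\<bar>) ` {I. is_interval I})"
proof -
  obtain C where C: "\<And>a b. \<bar>integral {a..b} f\<bar> \<le> C"
    using HK_bounded_compact_intervals[OF assms] by blast
  have C0: "0 \<le> C" using C[of 0 0] by simp
  have bd: "\<bar>integral I f\<bar> \<le> C" if I: "is_interval I" "bounded I" for I
  proof -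
    have "connected (closure I)" "compact (closure I)"
      using I by (auto simp: is_interval_connected connected_imp_connected_closure compact_closure)
    then obtain a b where ab: "closure I = {a..b}"
      by (metis connected_compact_interval_1)
    have "negligible (frontier I)"
      using I(1) by (intro negligible_convex_frontier is_interval_convex)
    moreover have "closure I - I \<subseteq> frontier I"
      using interior_subset by (auto simp: frontier_def)
    ultimately have "negligible (closure I - I)" by (rule negligible_subset)
    then have "integral I f = integral (closure I) f"
      using closure_subset[of I]
      by (intro integral_spike_set) (auto intro: negligible_subset simp: subset_iff)
    then show ?thesis using C ab by simp
  qed
  have "\<bar>integral I f\<bar> \<le> C" if I: "is_interval I" for I
  proof (cases "f integrable_on I \<and> \<not> bounded I")
    case True
    then have nb: "\<nexists>a b. I = cbox a b" by (metis bounded_cbox)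
    show ?thesis
    proof (rule field_le_epsilon)
      fix e :: real assume "e > 0"
      from has_integral_altD[OF integrable_integral nb this, of f] True obtain B where
        "\<forall>a b. ball 0 B \<subseteq> cbox a b \<longrightarrow> (\<exists>z. ((\<lambda>x. if x \<in> I then f x else 0) has_integral z) (cbox a b)
            \<and> norm (z - integral I f) < e)" by metis
      moreover have "ball 0 B \<subseteq> cbox (-B) B" by (auto simp: dist_real_def)
      ultimately obtain z where z:
        "((\<lambda>x. if x \<in> I then f x else 0) has_integral z) (cbox (-B) B)" "\<bar>z - integral I f\<bar> < e"
        unfolding real_norm_def by blast
      have "z = integral (I \<inter> cbox (-B) B) f"
        using z(1) by (metis has_integral_restrict_Int integral_unique)
      moreover have "is_interval (I \<inter> cbox (-B) B)" "bounded (I \<inter> cbox (-B) B)"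
        using I by (auto intro: is_interval_Int is_interval_cbox bounded_subset[OF bounded_cbox])
      ultimately have "\<bar>z\<bar> \<le> C" using bd by metis
      then show "\<bar>integral I f\<bar> \<le> C + e" using z(2) by linarith
    qed
  next
    case False
    then show ?thesis using bd[OF I] C0 by (auto simp: not_integrable_integral)
  qed
  then show ?thesis by (intro bdd_aboveI[of _ C]) auto
qed

end

theory Submission
  imports Defs
begin

text \<open>
  The integral of \<open>translate x f - f\<close> over \<open>[a, b]\<close> telescopes: up to sign it is the difference of
  the integrals of \<open>f\<close> over two intervals of length \<open>\<bar>x\<bar>\<close>, one next to \<open>a\<close> and one next to \<open>b\<close>
  (\<open>integral_translate_diff_le\<close>). So it suffices that integrals of \<open>f\<close> over short intervals are
  uniformly small, wherever the interval lies (\<open>HK_short_intervals\<close>). This is the uniform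
  continuity of a primitive of \<open>f\<close> on the real line: a primitive is continuous, and it has
  finite limits at both infinities because \<open>f\<close> is integrable on the whole line.
  Compact intervals are enough, because they already determine the Alexiewicz norm
  (\<open>alexiewicz_norm_le\<close>).
\<close>

text \<open>
  A bounded interval differs from its closure, a compact interval, by a null set. The integral
  over an unbounded interval is a limit of integrals over its bounded truncations. An interval
  on which \<open>g\<close> is not integrable contributes \<open>0\<close>, the default value of the integral.
\<close>
lemma abs_integral_interval_le:
  fixes g :: "real \<Rightarrow> real"
  assumes C: "\<And>a b. \<bar>integral {a..b} g\<bar> \<le> C" and I: "is_interval I"
  shows "\<bar>integral I g\<bar> \<le> C"
proof (cases "g integrable_on I")
  case False
  then show ?thesis using C[of 1 0] by (simp add: not_integrable_integral)
next
  case True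
  have bounded_case: "\<bar>integral J g\<bar> \<le> C" if J: "is_interval J" "bounded J" for J
  proof -
    have "connected (closure J)" "compact (closure J)"
      using J by (auto simp: is_interval_connected connected_imp_connected_closure compact_closure)
    then obtain a b where ab: "closure J = {a..b}"
      by (metis connected_compact_interval_1)
    have "negligible (closure J - J)"
      using negligible_convex_frontier[OF is_interval_convex[OF J(1)]]
      by (rule negligible_subset) (use interior_subset in \<open>auto simp: frontier_def\<close>)
    then have "integral J g = integral (closure J) g"
      using closure_subset[of J]
      by (intro integral_spike_set) (auto intro: negligible_subset simp: subset_iff)
    then show ?thesis using C ab by simp
  qed
  show ?thesis
  proof (rule field_le_epsilon)
    fix e :: real assume "e > 0"
    then obtain B where B: "\<And>a b. ball 0 B \<subseteq> cbox a b \<Longrightarrow>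
        \<bar>integral (cbox a b) (\<lambda>x. if x \<in> I then g x else 0) - integral I g\<bar> < e"
      using integrable_integral[OF True] unfolding has_integral_alt' real_norm_def by blast
    have "ball 0 B \<subseteq> cbox (-B) B" by (auto simp: dist_real_def)
    from B[OF this] have "\<bar>integral (I \<inter> cbox (-B) B) g - integral I g\<bar> < e"
      by (simp only: integral_restrict_Int)
    moreover have "\<bar>integral (I \<inter> cbox (-B) B) g\<bar> \<le> C"
      using I by (intro bounded_case)
        (auto intro: is_interval_Int is_interval_cbox bounded_subset[OF bounded_cbox])
    ultimately show "\<bar>integral I g\<bar> \<le> C + e" by linarith
  qed
qed

lemma
  fixes g :: "real \<Rightarrow> real"
  assumes "\<And>a b. \<bar>integral {a..b} g\<bar> \<le> C"
  shows alexiewicz_norm_le: "alexiewicz_norm g \<le> C"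
    and alexiewicz_norm_nonneg: "0 \<le> alexiewicz_norm g"
proof -
  have le: "\<bar>integral I g\<bar> \<le> C" if "is_interval I" for I
    using abs_integral_interval_le[OF assms that] .
  show "alexiewicz_norm g \<le> C"
    unfolding alexiewicz_norm_def using le is_interval_empty by (intro cSUP_least) auto
  have "\<bar>integral {} g\<bar> \<le> alexiewicz_norm g"
    unfolding alexiewicz_norm_def using le
    by (intro cSUP_upper bdd_aboveI[of _ C]) auto
  then show "0 \<le> alexiewicz_norm g" by simp
qed

text \<open>
  Far out on either side the integrals from a fixed point are close to their limit, so the integral
  over any interval there is small (a Cauchy argument). The remaining short intervals lie in
  one compact interval, where an indefinite integral is uniformly continuous.
\<close>
lemma HK_short_intervals:
  fixes f :: "real \<Rightarrow> real"
  assumes f: "f integrable_on UNIV" and "e > 0"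
  obtains d where "d > 0" "\<And>a b. a \<le> b \<Longrightarrow> b - a < d \<Longrightarrow> \<bar>integral {a..b} f\<bar> < e"
proof -
  have int: "f integrable_on {a..b}" for a b
    using integrable_on_subinterval[OF f] by auto
  have comb: "integral {a..b} f + integral {b..c} f = integral {a..c} f"
    if "a \<le> b" "b \<le> c" for a b c
    using Henstock_Kurzweil_Integration.integral_combine[OF that int] .
  obtain B where "B > 0" and B: "\<And>a b. ball 0 B \<subseteq> cbox a b \<Longrightarrow>
      \<bar>integral (cbox a b) f - integral UNIV f\<bar> < e/2"
    using integrable_integral[OF f] half_gt_zero[OF \<open>e > 0\<close>]
    unfolding has_integral_alt' real_norm_def if_P[OF UNIV_I] by blast
  have tail: "\<bar>integral {a..b} f - integral UNIV f\<bar> < e/2" if "a \<le> -B" "B \<le> b" for a b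
    using that B[of a b] by (force simp: dist_real_def)
  define P where "P t = integral {-B-1..t} f" for t
  have "uniformly_continuous_on {-B-1..B+1} P"
    unfolding P_def by (intro compact_uniformly_continuous indefinite_integral_continuous_1 int) simp
  then obtain d where "d > 0" and d: "\<And>a b. a \<in> {-B-1..B+1} \<Longrightarrow> b \<in> {-B-1..B+1} \<Longrightarrow>
      \<bar>b - a\<bar> < d \<Longrightarrow> \<bar>P b - P a\<bar> < e"
    using \<open>e > 0\<close> unfolding uniformly_continuous_on_def dist_real_def by metis
  show thesis
    (* The length bound 1 is the margin by which the compact interval exceeds [-B, B]. *)
  proof (rule that[of "min d 1"])
    fix a b :: real assume ab: "a \<le> b" "b - a < min d 1"
    consider "B \<le> a" | "b \<le> -B" | "-B-1 \<le> a" "b \<le> B+1"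
      using ab by linarith
    then show "\<bar>integral {a..b} f\<bar> < e"
    proof cases
      case 1
      then show ?thesis
        using comb[of "-B" a b] tail[of "-B" a] tail[of "-B" b] ab \<open>B > 0\<close> by linarith
    next
      case 2
      then show ?thesis
        using comb[of a b B] tail[of a B] tail[of b B] ab \<open>B > 0\<close> by linarith
    next
      case 3
      then show ?thesis
        using comb[of "-B-1" a b] d[of a b] ab by (auto simp: P_def)
    qed
  qed (use \<open>d > 0\<close> in simp)
qed

lemma has_integral_translate:
  fixes f :: "real \<Rightarrow> real"
  assumes "f integrable_on {a - x..b - x}"
  shows "(translate x f has_integral integral {a - x..b - x} f) {a..b}"
  using has_integral_shift_real_ivl[OF integrable_integral[OF assms], of "-x"]
  by (simp add: translate_def)

text \<open>
  \<open>[a - x, b - x]\<close> and \<open>[a, b]\<close> share their middle part, which cancels. If \<open>b - a < \<bar>x\<bar>\<close> they are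
  disjoint, and the same identity holds because both sides complete to the integral over the hull.
\<close>
lemma integral_translate_diff_le:
  fixes f :: "real \<Rightarrow> real"
  assumes int: "\<And>a b. f integrable_on {a..b}"
    and small: "\<And>a b. a \<le> b \<Longrightarrow> b - a \<le> \<bar>x\<bar> \<Longrightarrow> \<bar>integral {a..b} f\<bar> \<le> e"
  shows "\<bar>integral {a..b} (\<lambda>y. translate x f y - f y)\<bar> \<le> 2 * e"
proof (cases "a \<le> b")
  case False
  then show ?thesis using small[of 0 0] by simp
next
  case True
  have comb: "integral {a..b} f + integral {b..c} f = integral {a..c} f"
    if "a \<le> b" "b \<le> c" for a b c
    using Henstock_Kurzweil_Integration.integral_combine[OF that int] .
  have eq: "integral {a..b} (\<lambda>y. translate x f y - f y)
      = integral {a - x..b - x} f - integral {a..b} f"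
    using has_integral_diff[OF has_integral_translate[OF int] integrable_integral[OF int]]
    by (rule integral_unique)
  show ?thesis
  proof (cases "0 \<le> x")
    case x: True
    have "integral {a - x..b - x} f + integral {b - x..b} f
        = integral {a - x..a} f + integral {a..b} f"
      using comb[of "a - x" "b - x" b] comb[of "a - x" a b] True x by simp
    then show ?thesis
      using small[of "a - x" a] small[of "b - x" b] eq x by (simp add: abs_le_iff)
  next
    case x: False
    have "integral {a..a - x} f + integral {a - x..b - x} f
        = integral {a..b} f + integral {b..b - x} f"
      using comb[of a "a - x" "b - x"] comb[of a b "b - x"] True x by simp
    then show ?thesis
      using small[of a "a - x"] small[of b "b - x"] eq x by (simp add: abs_le_iff)
  qed
qed

theorem theorem1:
  fixes f :: "real \<Rightarrow> real"
  assumes "f \<in> HK"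
  shows "((\<lambda>x. alexiewicz_norm (\<lambda>y. translate x f y - f y)) \<longlongrightarrow> 0) (at 0)"
proof (rule tendstoI)
  fix e :: real assume "e > 0"
  have f: "f integrable_on UNIV" using assms by (simp add: HK_def)
  have int: "f integrable_on {a..b}" for a b
    using integrable_on_subinterval[OF f] by auto
  obtain d where "d > 0" and d: "\<And>a b. a \<le> b \<Longrightarrow> b - a < d \<Longrightarrow> \<bar>integral {a..b} f\<bar> < e/3"
    using HK_short_intervals[OF f, of "e/3"] \<open>e > 0\<close> by auto
  have "dist (alexiewicz_norm (\<lambda>y. translate x f y - f y)) 0 < e" if "\<bar>x\<bar> < d" for x
  proof -
    have "\<bar>integral {a..b} (\<lambda>y. translate x f y - f y)\<bar> \<le> 2 * (e/3)" for a b
      using that by (intro integral_translate_diff_le int less_imp_le[OF d]) auto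
    from alexiewicz_norm_le[OF this] alexiewicz_norm_nonneg[OF this] show ?thesis
      using \<open>e > 0\<close> by (simp add: dist_real_def)
  qed
  then show "\<forall>\<^sub>F x in at 0. dist (alexiewicz_norm (\<lambda>y. translate x f y - f y)) 0 < e"
    using \<open>d > 0\<close> by (auto simp: eventually_at dist_real_def)
qed

end
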